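(* Let $m\in(0,\infty)$, $\nu>0$ and $p\in(0,1)$ be fixed, and let $\mathrm{P}(X=k\mid z,\nu,m,n)$ be the probability mass function of the COM-negative hypergeometric random variable $X$ with parameters $(z,\nu,m,n)$, where $z$ and $n$ satisfy $\frac{z}{n+z}=p^{1/\nu}$. Then, for every $k=0,1,2,\ldots$, $$\lim_{n\to\infty}\mathrm{P}(X=k\mid z,\nu,m,n)=\left(\frac{\Gamma(m+k)}{k!\,\Gamma(m)}\right)^{\nu}p^k(1-p)^m\frac{1}{C(m,\nu,p)},$$ where $C(m,\nu,p)=\sum_{i=0}^{\infty}\left(\frac{\Gamma(m+i)}{i!\,\Gamma(m)}\right)^{\nu}p^i(1-p)^m$.
   Context: For a positive integer $z$ and real $\nu,m,n>0$, the COM-negative hypergeometric distribution with parameters $(z,\nu,m,n)$ has probability mass function $$\mathrm{P}(X=k\mid z,\nu,m,n)=\frac{1}{N(m,n,z,\nu)}\left(\binom{z}{k}\frac{\mathrm{B}(m+k,n+z-k)}{\mathrm{B}(m,n)}\right)^{\nu},\quad k=0,1,\ldots,z,$$ where $\mathrm{B}$ is the Beta function and $$N(m,n,z,\nu)=\sum_{x=0}^{z}\left(\binom{z}{x}\frac{\mathrm{B}(m+x,n+z-x)}{\mathrm{B}(m,n)}\right)^{\nu}.$$ The probability is $0$ for integers $k>z$. The limit $n\to\infty$ is taken along values of $n$ for which $z$, determined by $\frac{z}{n+z}=p^{1/\nu}$, is a positive integer (so $z\to\infty$ as well). *)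

theory Defs
  imports "HOL-Probability.Probability" "HOL-Library.Going_To_Filter"
begin

definition com_neg_hyp_weight :: "nat \<Rightarrow> real \<Rightarrow> real \<Rightarrow> real \<Rightarrow> nat \<Rightarrow> real" where
  "com_neg_hyp_weight z \<nu> m n k =
     (real (z choose k) * Beta (m + real k) (n + real z - real k) / Beta m n) powr \<nu>"

definition com_neg_hyp_normalizer :: "real \<Rightarrow> real \<Rightarrow> nat \<Rightarrow> real \<Rightarrow> real" where
  "com_neg_hyp_normalizer m n z \<nu> = (\<Sum>x = 0..z. com_neg_hyp_weight z \<nu> m n x)"

definition com_neg_hyp_mass :: "nat \<Rightarrow> real \<Rightarrow> real \<Rightarrow> real \<Rightarrow> nat \<Rightarrow> real" where
  "com_neg_hyp_mass z \<nu> m n k =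
     (if k \<le> z then com_neg_hyp_weight z \<nu> m n k / com_neg_hyp_normalizer m n z \<nu> else 0)"

text \<open>
  The embedding into \<^typ>\<open>nat pmf\<close> is meaningful only for masses that are
  nonnegative and add up to 1; \<open>pmf_com_neg_hyp\<close> below shows that this is the case for
  all positive parameters.
\<close>

definition com_neg_hyp_pmf :: "nat \<Rightarrow> real \<Rightarrow> real \<Rightarrow> real \<Rightarrow> nat pmf" where
  "com_neg_hyp_pmf z \<nu> m n = embed_pmf (com_neg_hyp_mass z \<nu> m n)"

lemma com_neg_hyp_weight_pos:
  assumes "m > 0" "n > 0" "k \<le> z"
  shows "com_neg_hyp_weight z \<nu> m n k > 0"
proof -
  have B: "Beta a b > 0" if "a > 0" "b > 0" for a b :: real
    using that by (simp add: Beta_def Gamma_real_pos)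
  have "real (z choose k) * Beta (m + real k) (n + real z - real k) / Beta m n > 0"
    using assms by (intro divide_pos_pos mult_pos_pos B) (auto simp: zero_less_binomial_iff)
  thus ?thesis unfolding com_neg_hyp_weight_def by (metis powr_gt_zero less_irrefl)
qed

lemma com_neg_hyp_normalizer_pos:
  assumes "m > 0" "n > 0"
  shows "com_neg_hyp_normalizer m n z \<nu> > 0"
  unfolding com_neg_hyp_normalizer_def
  using assms by (intro sum_pos com_neg_hyp_weight_pos) auto

lemma com_neg_hyp_mass_nonneg:
  assumes "m > 0" "n > 0"
  shows "com_neg_hyp_mass z \<nu> m n k \<ge> 0"
  using com_neg_hyp_weight_pos[OF assms, of k z \<nu>] com_neg_hyp_normalizer_pos[OF assms, of z \<nu>]
  by (auto simp: com_neg_hyp_mass_def)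

lemma pmf_com_neg_hyp:
  assumes "m > 0" "n > 0"
  shows "pmf (com_neg_hyp_pmf z \<nu> m n) k = com_neg_hyp_mass z \<nu> m n k"
  unfolding com_neg_hyp_pmf_def
proof (rule pmf_embed_pmf)
  show nonneg: "0 \<le> com_neg_hyp_mass z \<nu> m n x" for x
    by (rule com_neg_hyp_mass_nonneg[OF assms])
  have "(\<integral>\<^sup>+x. ennreal (com_neg_hyp_mass z \<nu> m n x) \<partial>count_space UNIV)
      = (\<Sum>x\<in>{0..z}. ennreal (com_neg_hyp_mass z \<nu> m n x))"
    by (rule nn_integral_count_space') (auto simp: com_neg_hyp_mass_def)
  also have "\<dots> = ennreal (\<Sum>x\<in>{0..z}. com_neg_hyp_mass z \<nu> m n x)"
    using nonneg by (simp add: sum_ennreal)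
  also have "(\<Sum>x\<in>{0..z}. com_neg_hyp_mass z \<nu> m n x)
      = (\<Sum>x\<in>{0..z}. com_neg_hyp_weight z \<nu> m n x) / com_neg_hyp_normalizer m n z \<nu>"
    by (simp add: com_neg_hyp_mass_def sum_divide_distrib)
  also have "\<dots> = 1"
    using com_neg_hyp_normalizer_pos[OF assms, of z \<nu>] by (simp add: com_neg_hyp_normalizer_def)
  finally show "(\<integral>\<^sup>+x. ennreal (com_neg_hyp_mass z \<nu> m n x) \<partial>count_space UNIV) = 1" by simp
qed

definition com_neg_bin_weight :: "real \<Rightarrow> real \<Rightarrow> real \<Rightarrow> nat \<Rightarrow> real" where
  "com_neg_bin_weight m \<nu> p i =
     (Gamma (m + real i) / (fact i * Gamma m)) powr \<nu> * p ^ i * (1 - p) powr m"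

definition com_neg_bin_normalizer :: "real \<Rightarrow> real \<Rightarrow> real \<Rightarrow> real" where
  "com_neg_bin_normalizer m \<nu> p = (\<Sum>i. com_neg_bin_weight m \<nu> p i)"

lemma summable_com_neg_bin_weight:
  assumes "m > 0" "0 < p" "p < 1"
  shows "summable (com_neg_bin_weight m \<nu> p)"
proof -
  have "((\<lambda>i::nat. (m + real i) / (real i + 1)) \<longlongrightarrow> 1) at_top"
    by real_asymp
  hence "((\<lambda>i::nat. ((m + real i) / (real i + 1)) powr \<nu> * p) \<longlongrightarrow> 1 powr \<nu> * p) at_top"
    by (intro tendsto_intros) auto
  moreover have "1 powr \<nu> * p < (1 + p) / 2" using assms by simp
  ultimately have "eventually (\<lambda>i::nat. ((m + real i) / (real i + 1)) powr \<nu> * p < (1 + p) / 2) at_top"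
    by (rule order_tendstoD)
  then obtain N where N: "\<And>i. i \<ge> N \<Longrightarrow> ((m + real i) / (real i + 1)) powr \<nu> * p < (1 + p) / 2"
    by (auto simp: eventually_at_top_linorder)
  show ?thesis
  proof (rule summable_ratio_test[of "(1 + p) / 2" N])
    show "(1 + p) / 2 < 1" using assms by simp
    fix i assume i: "N \<le> i"
    have G: "Gamma (m + real j) > 0" for j
      using assms by (intro Gamma_real_pos) auto
    have "m + real i \<notin> \<int>\<^sub>\<le>\<^sub>0"
      using assms nonpos_Ints_nonpos[of "m + real i"] by (auto simp: not_le)
    hence "Gamma (m + real (Suc i)) = (m + real i) * Gamma (m + real i)"
      using Gamma_plus1[of "m + real i"] by (simp add: add_ac)
    hence "Gamma (m + real (Suc i)) / (fact (Suc i) * Gamma m)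
         = ((m + real i) / (real i + 1)) * (Gamma (m + real i) / (fact i * Gamma m))"
      by (simp add: add_ac)
    moreover have "(((m + real i) / (real i + 1)) * (Gamma (m + real i) / (fact i * Gamma m))) powr \<nu>
        = ((m + real i) / (real i + 1)) powr \<nu> * (Gamma (m + real i) / (fact i * Gamma m)) powr \<nu>"
      by (rule powr_mult)
    ultimately have "com_neg_bin_weight m \<nu> p (Suc i)
        = (((m + real i) / (real i + 1)) powr \<nu> * p) * com_neg_bin_weight m \<nu> p i"
      unfolding com_neg_bin_weight_def by (simp only: power_Suc mult_ac)
    moreover have "com_neg_bin_weight m \<nu> p i \<ge> 0"
      using assms by (simp add: com_neg_bin_weight_def)
    moreover have "0 \<le> ((m + real i) / (real i + 1)) powr \<nu> * p" using assms by simp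
    ultimately show "norm (com_neg_bin_weight m \<nu> p (Suc i)) \<le> (1 + p) / 2 * norm (com_neg_bin_weight m \<nu> p i)"
      using mult_right_mono[OF less_imp_le[OF N[OF i]], of "com_neg_bin_weight m \<nu> p i"]
      by (metis abs_of_nonneg mult_nonneg_nonneg real_norm_def)
  qed
qed

text \<open>
  For given \<open>n\<close>, a positive integer \<open>z\<close> with \<open>z / (n + z) = p powr (1 / \<nu>)\<close> exists only for
  some values of \<open>n\<close>, and then it is unique.  Hence \<open>n \<rightarrow> \<infinity>\<close> is taken over the
  set of admissible pairs \<open>(z, n)\<close>.
\<close>

definition admissible :: "real \<Rightarrow> real \<Rightarrow> (nat \<times> real) set" where
  "admissible \<nu> p =
     {(z, n). 0 < z \<and> 0 < n \<and> real z / (n + real z) = p powr (1 / \<nu>)}"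

lemma admissible_filter_neq_bot:
  assumes "\<nu> > 0" "0 < p" "p < 1"
  shows "(snd going_to at_top within admissible \<nu> p) \<noteq> bot"
proof
  assume "(snd going_to at_top within admissible \<nu> p) = bot"
  hence "eventually (\<lambda>_. False) (snd going_to at_top within admissible \<nu> p)" by simp
  then obtain N where N: "\<And>z n. n \<ge> N \<Longrightarrow> (z, n) \<notin> admissible \<nu> p"
    by (auto simp: going_to_within_def eventually_inf_principal eventually_filtercomap
          eventually_at_top_linorder)
  define q where "q = p powr (1 / \<nu>)"
  have q: "0 < q" "q < 1" using assms powr_less_mono2[of "1/\<nu>" p 1] by (auto simp: q_def)
  define z where "z = Suc (nat \<lceil>\<bar>N\<bar> * q / (1 - q)\<rceil>)"
  define n where "n = real z * (1 - q) / q"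
  have "\<bar>N\<bar> * q / (1 - q) \<le> real z" unfolding z_def by linarith
  hence "\<bar>N\<bar> \<le> n" using q by (simp add: n_def field_simps)
  hence "N \<le> n" by linarith
  moreover have "real z > 0" "z > 0" by (auto simp: z_def)
  hence "(z, n) \<in> admissible \<nu> p"
    using q by (simp add: admissible_def n_def flip: q_def) (simp add: field_simps)
  ultimately show False using N by blast
qed

end

theory Submission
  imports Defs
begin

text \<open>
  Dividing the weights by the weight of \<open>0\<close> turns them into powers of products of \<open>k\<close> factors
  \<open>(z - j) / (n + z - 1 - j)\<close>, each of which tends to \<open>p powr (1 / \<nu>)\<close>.  For \<open>n \<ge> 1\<close>
  the factors decrease in \<open>j\<close>, so the one with \<open>j = 0\<close> gives a negative binomial majorant with
  some parameter in \<open>{p<..<1}\<close>, and Tannery's theorem handles the normalizer.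
\<close>

text \<open>The functional equation of \<open>Gamma\<close> is applied to both arguments; their sum,
  and so the denominator of \<open>Beta\<close>, does not change.\<close>

lemma Beta_shift:
  fixes a b :: real
  assumes "a > 0" "b > 1"
  shows "Beta (a + 1) (b - 1) = Beta a b * (a / (b - 1))"
proof -
  have "a \<notin> \<int>\<^sub>\<le>\<^sub>0" "b - 1 \<notin> \<int>\<^sub>\<le>\<^sub>0"
    using assms nonpos_Ints_nonpos by force+
  hence "Gamma (a + 1) = a * Gamma a" "Gamma b = (b - 1) * Gamma (b - 1)"
    using Gamma_plus1[of a] Gamma_plus1[of "b - 1"] by simp_all
  thus ?thesis
    using assms by (simp add: Beta_def)
qed

lemma binomial_Suc_right:
  assumes "k \<le> n"
  shows "real (n choose Suc k) = real (n choose k) * ((real n - real k) / real (Suc k))"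
proof -
  have "real (Suc k) * real (n choose Suc k) = (real n - real k) * real (n choose k)"
    using assms binomial_absorb_comp[of n k] binomial_absorption[of k n]
    by (metis of_nat_diff of_nat_mult)
  thus ?thesis by (simp add: field_simps)
qed

text \<open>By induction: passing from \<open>k\<close> to \<open>Suc k\<close> multiplies the
  binomial coefficient by (z - k) / (k + 1) and the Beta value by (m + k) / (n + z - 1 - k).
  Exchanging the numerators gives the next factor of the Gamma quotient, which is free of
  \<open>z\<close> and \<open>n\<close>, and the next factor of the product.\<close>

lemma binomial_mult_Beta:
  fixes m n :: real
  assumes "m > 0" "n > 0" "k \<le> z"
  shows "real (z choose k) * Beta (m + real k) (n + real z - real k) =
           Beta m (n + real z) * (Gamma (m + real k) / (fact k * Gamma m) *
             (\<Prod>j<k. (real z - real j) / (n + real z - 1 - real j)))"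
  using assms(3)
proof (induction k)
  case 0
  have "Gamma m \<noteq> 0" using Gamma_real_pos[OF assms(1)] by simp
  thus ?case by simp
next
  case (Suc k)
  have "m + real k \<notin> \<int>\<^sub>\<le>\<^sub>0"
    using assms nonpos_Ints_nonpos[of "m + real k"] by force
  hence G: "Gamma (m + real (Suc k)) / (fact (Suc k) * Gamma m) =
          Gamma (m + real k) / (fact k * Gamma m) * ((m + real k) / real (Suc k))"
    using Gamma_plus1[of "m + real k"] by (simp add: add_ac mult_ac)
  have B: "Beta (m + real (Suc k)) (n + real z - real (Suc k)) =
          Beta (m + real k) (n + real z - real k) * ((m + real k) / (n + real z - 1 - real k))"
    using Beta_shift[of "m + real k" "n + real z - real k"] assms Suc.prems
    by (simp add: algebra_simps)
  have "real (z choose Suc k) * Beta (m + real (Suc k)) (n + real z - real (Suc k)) =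
          real (z choose k) * Beta (m + real k) (n + real z - real k) *
            ((m + real k) / real (Suc k) * ((real z - real k) / (n + real z - 1 - real k)))"
    unfolding B using binomial_Suc_right[of k z] Suc.prems by simp
  also have "\<dots> = Beta m (n + real z) * (Gamma (m + real k) / (fact k * Gamma m) *
             (\<Prod>j<k. (real z - real j) / (n + real z - 1 - real j))) *
            ((m + real k) / real (Suc k) * ((real z - real k) / (n + real z - 1 - real k)))"
    using Suc.IH Suc.prems by (simp del: of_nat_Suc)
  finally show ?case
    unfolding G prod.lessThan_Suc by (simp only: mult_ac)
qed

text \<open>The factor \<open>Beta m (n + real z) / Beta m n\<close>, common to all
  \<open>k\<close>, is the base of the weight at 0.\<close>

lemma com_neg_hyp_weight_eq:
  assumes "m > 0" "n > 0"
  shows "com_neg_hyp_weight z \<nu> m n k =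
           com_neg_hyp_weight z \<nu> m n 0 * (Gamma (m + real k) / (fact k * Gamma m) *
             (\<Prod>j<k. (real z - real j) / (n + real z - 1 - real j))) powr \<nu>"
proof (cases "k \<le> z")
  case True
  thus ?thesis
    unfolding com_neg_hyp_weight_def binomial_mult_Beta[OF assms True]
    by (simp add: mult_ac flip: powr_mult)
next
  case False
  \<comment> \<open>Beyond \<open>z\<close> the product contains the factor with
    \<open>j = z\<close>, whose numerator is 0. Since \<open>0 powr \<nu> = 0\<close> for every
    \<nu>, both sides vanish.\<close>
  hence P: "(\<Prod>j<k. (real z - real j) / (n + real z - 1 - real j)) = 0"
    by (intro prod_zero) (auto intro!: bexI[of _ z])
  thus ?thesis
    using False unfolding P by (simp add: com_neg_hyp_weight_def)
qed

text \<open>The right-hand side mentions neither \<open>z\<close> nor \<open>n\<close>, as a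
  majorant for Tannery's theorem requires.\<close>

lemma com_neg_hyp_weight_ratio_le:
  assumes "m > 0" "n \<ge> 1" "z > 0" "\<nu> > 0" "real z / (n + real z - 1) \<le> r"
  shows "com_neg_hyp_weight z \<nu> m n k / com_neg_hyp_weight z \<nu> m n 0 \<le>
           (Gamma (m + real k) / (fact k * Gamma m)) powr \<nu> * (r powr \<nu>) ^ k"
proof (cases "k \<le> z")
  case True
  have G: "Gamma (m + real k) / (fact k * Gamma m) \<ge> 0"
    using assms by (auto intro!: divide_nonneg_nonneg mult_nonneg_nonneg less_imp_le Gamma_real_pos)
  have r: "r > 0"
  proof -
    have "0 < real z / (n + real z - 1)"
      using assms by (intro divide_pos_pos) auto
    with assms show ?thesis by linarith
  qed
  let ?P = "\<Prod>j<k. (real z - real j) / (n + real z - 1 - real j)"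
  have fac: "0 \<le> (real z - real j) / (n + real z - 1 - real j) \<and>
        (real z - real j) / (n + real z - 1 - real j) \<le> r" if "j < k" for j
  proof -
    have j: "real j < real z" using that True by linarith
    \<comment> \<open>After cross-multiplication, comparing the factor at \<open>j\<close> with the
      factor at 0 comes down to this inequality.\<close>
    have "real j \<le> n * real j" using assms mult_right_mono[of 1 n "real j"] by simp
    hence "(real z - real j) / (n + real z - 1 - real j) \<le> real z / (n + real z - 1)"
      using j assms by (simp add: divide_simps) (simp add: algebra_simps)
    thus ?thesis using j assms by auto
  qed
  have P: "0 \<le> ?P" "?P \<le> r ^ k"
    using fac prod_mono[of "{..<k}" "\<lambda>j. (real z - real j) / (n + real z - 1 - real j)" "\<lambda>_. r"]
    by (auto intro!: prod_nonneg)
  have "com_neg_hyp_weight z \<nu> m n k / com_neg_hyp_weight z \<nu> m n 0 =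
          (Gamma (m + real k) / (fact k * Gamma m) * ?P) powr \<nu>"
    using com_neg_hyp_weight_eq[of m n z \<nu> k] com_neg_hyp_weight_pos[of m n 0 z \<nu>] assms by simp
  also have "\<dots> \<le> (Gamma (m + real k) / (fact k * Gamma m) * r ^ k) powr \<nu>"
    using G P assms by (intro powr_mono2 mult_left_mono mult_nonneg_nonneg) auto
  also have "\<dots> = (Gamma (m + real k) / (fact k * Gamma m)) powr \<nu> * (r powr \<nu>) ^ k"
    unfolding powr_mult using r by (simp add: powr_powr mult_ac flip: powr_realpow)
  finally show ?thesis .
next
  case False
  thus ?thesis by (simp add: com_neg_hyp_weight_def binomial_eq_0)
qed

text \<open>Common factors cancel between weight and normalizer, and the terms beyond
  \<open>z\<close> vanish, so the normalizer can be written as an infinite series. The scale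
  \<open>c\<close> is left free so that it can later match the constant in the limiting
  weights.\<close>

lemma com_neg_hyp_mass_eq:
  fixes m n c \<nu> :: real and z k :: nat
  assumes "m > 0" "n > 0" "c \<noteq> 0"
  defines "w \<equiv> \<lambda>i. c * (com_neg_hyp_weight z \<nu> m n i / com_neg_hyp_weight z \<nu> m n 0)"
  shows "com_neg_hyp_mass z \<nu> m n k = w k / suminf w"
proof -
  have 0: "w i = 0" if "i > z" for i
    using that by (simp add: w_def com_neg_hyp_weight_def)
  have "suminf w = (\<Sum>i = 0..z. w i)"
    using 0 by (intro suminf_finite) auto
  also have "\<dots> = c * (com_neg_hyp_normalizer m n z \<nu> / com_neg_hyp_weight z \<nu> m n 0)"
    by (simp add: w_def com_neg_hyp_normalizer_def sum_divide_distrib sum_distrib_left)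
  finally have s: "suminf w = c * (com_neg_hyp_normalizer m n z \<nu> / com_neg_hyp_weight z \<nu> m n 0)" .
  show ?thesis
  proof (cases "k \<le> z")
    case True
    thus ?thesis unfolding s
      using com_neg_hyp_weight_pos[of m n 0 z \<nu>] assms by (simp add: com_neg_hyp_mass_def w_def)
  qed (simp add: com_neg_hyp_mass_def 0)
qed

text \<open>On admissible pairs \<open>z\<close> is a fixed multiple of \<open>n\<close>, so the
  factor is a function of \<open>n\<close> alone; the fixed shifts by \<open>j\<close> and 1 do not
  affect its limit.\<close>

lemma tendsto_admissible_factor:
  assumes "\<nu> > 0" "0 < p" "p < 1"
  shows "((\<lambda>(z, n). (real z - real j) / (n + real z - 1 - real j)) \<longlongrightarrow> p powr (1 / \<nu>))
           (snd going_to at_top within admissible \<nu> p)"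
proof -
  define q where "q = p powr (1 / \<nu>)"
  have q: "0 < q" "q < 1"
    using assms powr_less_mono2[of "1 / \<nu>" p 1] by (auto simp: q_def)
  define h where "h = (\<lambda>n. (n * (q / (1 - q)) - real j) / (n + n * (q / (1 - q)) - 1 - real j))"
  \<comment> \<open>This is the constant ratio z / n on admissible pairs.\<close>
  define c where "c = q / (1 - q)"
  have c: "c > 0" "c / (1 + c) = q"
    using q by (auto simp: c_def field_simps)
  have "((\<lambda>n. (n * c - real j) / (n + n * c - 1 - real j)) \<longlongrightarrow> c / (1 + c)) at_top"
    using c(1) by (real_asymp simp: divide_inverse)
  hence "(h \<longlongrightarrow> q) at_top"
    unfolding h_def by (simp add: c(2) flip: c_def)
  hence "((\<lambda>x. h (snd x)) \<longlongrightarrow> q) (snd going_to at_top within admissible \<nu> p)"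
    by (rule filterlim_compose) (rule filterlim_going_toI_weak)
  moreover have "h (snd x) = (case x of (z, n) \<Rightarrow> (real z - real j) / (n + real z - 1 - real j))"
    if "x \<in> admissible \<nu> p" for x
  proof -
    obtain z n where x: "x = (z, n)" by (cases x)
    have "real z / (n + real z) = q" "n + real z > 0"
      using that by (auto simp: x admissible_def q_def)
    hence "real z * (1 - q) = n * q"
      by (simp add: divide_eq_eq algebra_simps)
    hence "real z = n * (q / (1 - q))"
      using q by (simp add: eq_divide_eq)
    thus ?thesis by (simp add: h_def x)
  qed
  hence "eventually (\<lambda>x. h (snd x) =
           (case x of (z, n) \<Rightarrow> (real z - real j) / (n + real z - 1 - real j)))
           (snd going_to at_top within admissible \<nu> p)"
    by (auto simp: eventually_going_to_at_top_linorder)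
  ultimately show ?thesis
    unfolding q_def by (rule Lim_transform_eventually)
qed

theorem theorem3p3:
  fixes m \<nu> p :: real and k :: nat
  assumes "m > 0" and "\<nu> > 0" and "0 < p" and "p < 1"
  shows "((\<lambda>(z, n). pmf (com_neg_hyp_pmf z \<nu> m n) k) \<longlongrightarrow>
           (Gamma (m + real k) / (fact k * Gamma m)) powr \<nu> * p ^ k * (1 - p) powr m
             * (1 / com_neg_bin_normalizer m \<nu> p))
         (snd going_to at_top within admissible \<nu> p)"
proof -
  define F where "F = (snd going_to at_top within admissible \<nu> p :: (nat \<times> real) filter)"
  have F: "F \<noteq> bot"
    unfolding F_def using assms by (intro admissible_filter_neq_bot)
  \<comment> \<open>With this scale the terms \<open>w i\<close> tend to the limiting weights
    themselves; it cancels again in the mass.\<close>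
  define c where "c = (1 - p) powr m"
  have c: "c > 0" using assms by (simp add: c_def)
  define w where "w = (\<lambda>i (z, n).
    c * (com_neg_hyp_weight z \<nu> m n i / com_neg_hyp_weight z \<nu> m n 0))"
  have adm: "eventually (\<lambda>(z, n). z > 0 \<and> n \<ge> 1) F"
    unfolding F_def eventually_going_to_at_top_linorder
    by (intro exI[of _ 1]) (auto simp: admissible_def)
  have lim: "(w i \<longlongrightarrow> com_neg_bin_weight m \<nu> p i) F" for i
  proof -
    \<comment> \<open>For fixed \<open>i\<close> the product has a fixed number of factors, each
      tending to \<open>p powr (1 / \<nu>)\<close>; the outer power \<nu> then turns the limit
      product into \<open>p ^ i\<close>.\<close>
    have "((\<lambda>x. c * (Gamma (m + real i) / (fact i * Gamma m) * (\<Prod>j<i. case x of (z, n) \<Rightarrow>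
            (real z - real j) / (n + real z - 1 - real j))) powr \<nu>) \<longlongrightarrow>
          c * (Gamma (m + real i) / (fact i * Gamma m) * (\<Prod>j<i. p powr (1 / \<nu>))) powr \<nu>) F"
      unfolding F_def using assms Gamma_real_pos[of m] Gamma_real_pos[of "m + real i"]
      by (intro tendsto_intros tendsto_admissible_factor) auto
    moreover have "eventually (\<lambda>x. c * (Gamma (m + real i) / (fact i * Gamma m) *
            (\<Prod>j<i. case x of (z, n) \<Rightarrow>
               (real z - real j) / (n + real z - 1 - real j))) powr \<nu> = w i x) F"
      using adm
    proof eventually_elim
      case (elim x)
      obtain z n where x: "x = (z, n)" by (cases x)
      show ?case
        using elim assms com_neg_hyp_weight_eq[of m n z \<nu> i] com_neg_hyp_weight_pos[of m n 0 z \<nu>]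
        by (simp add: x w_def)
    qed
    ultimately have *: "(w i \<longlongrightarrow>
        c * (Gamma (m + real i) / (fact i * Gamma m) * (\<Prod>j<i. p powr (1 / \<nu>))) powr \<nu>) F"
      by (rule Lim_transform_eventually)
    have P: "(\<Prod>j<i. p powr (1 / \<nu>)) powr \<nu> = p ^ i"
      using assms by (simp add: powr_powr mult_ac flip: powr_realpow)
    have "c * (Gamma (m + real i) / (fact i * Gamma m) * (\<Prod>j<i. p powr (1 / \<nu>))) powr \<nu> =
             com_neg_bin_weight m \<nu> p i"
      unfolding powr_mult P by (simp add: com_neg_bin_weight_def c_def)
    with * show ?thesis by (simp only:)
  qed
  \<comment> \<open>Any value strictly between \<open>p\<close> and 1 would serve: being below 1
    makes the majorant summable, and being above \<open>p\<close> makes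
    \<open>s powr (1 / \<nu>)\<close> eventually exceed the factor with
    \<open>j = 0\<close>.\<close>
  define s where "s = (1 + p) / 2"
  have s: "p < s" "0 < s" "s < 1" using assms by (auto simp: s_def)
  have "p powr (1 / \<nu>) < s powr (1 / \<nu>)"
    using assms s by (intro powr_less_mono2) auto
  hence "eventually (\<lambda>x. (case x of (z, n) \<Rightarrow> (real z - real 0) / (n + real z - 1 - real 0))
           < s powr (1 / \<nu>)) F"
    unfolding F_def using assms by (intro order_tendstoD(2)[OF tendsto_admissible_factor])
  \<comment> \<open>The prefactor exchanges the constant \<open>(1 - s) powr m\<close> inside
    \<open>com_neg_bin_weight m \<nu> s\<close> for the constant \<open>c\<close> of
    \<open>w\<close>.\<close>
  hence bound: "eventually (\<lambda>x. \<forall>i. norm (w i x) \<le>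
                  c / (1 - s) powr m * com_neg_bin_weight m \<nu> s i) F"
    using adm
  proof eventually_elim
    case (elim x)
    obtain z n where x: "x = (z, n)" by (cases x)
    show ?case
    proof
      fix i
      have "0 \<le> w i x"
        using c by (simp add: w_def x com_neg_hyp_weight_def)
      moreover have "com_neg_hyp_weight z \<nu> m n i / com_neg_hyp_weight z \<nu> m n 0 \<le>
          (Gamma (m + real i) / (fact i * Gamma m)) powr \<nu> * ((s powr (1 / \<nu>)) powr \<nu>) ^ i"
        using elim assms by (intro com_neg_hyp_weight_ratio_le) (auto simp: x)
      hence "w i x \<le> c * ((Gamma (m + real i) / (fact i * Gamma m)) powr \<nu> * s ^ i)"
        using c s assms unfolding w_def x prod.case by (intro mult_left_mono) (auto simp: powr_powr)
      ultimately show "norm (w i x) \<le> c / (1 - s) powr m * com_neg_bin_weight m \<nu> s i"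
        using s by (simp add: com_neg_bin_weight_def)
    qed
  qed
  \<comment> \<open>Tannery's theorem takes the bound along a product filter; here it holds for all
    \<open>i\<close> at once, so only the pair \<open>x\<close> has to be far out.\<close>
  have ev: "eventually (\<lambda>(i, x). norm (w i x) \<le>
          c / (1 - s) powr m * com_neg_bin_weight m \<nu> s i) (at_top \<times>\<^sub>F F)"
    using eventually_compose_filterlim[OF bound filterlim_snd] by eventually_elim auto
  have summ: "summable (\<lambda>i. c / (1 - s) powr m * com_neg_bin_weight m \<nu> s i)"
    using assms s by (intro summable_mult summable_com_neg_bin_weight)
  have lim_sum: "((\<lambda>x. \<Sum>i. w i x) \<longlongrightarrow> com_neg_bin_normalizer m \<nu> p) F"
    using tannerys_theorem[where a = w, OF lim ev summ F]
    unfolding com_neg_bin_normalizer_def by blast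
  \<comment> \<open>The limit of the denominators must be nonzero before passing to the
    quotient.\<close>
  have "com_neg_bin_normalizer m \<nu> p > 0"
    unfolding com_neg_bin_normalizer_def
  proof (rule suminf_pos)
    show "summable (com_neg_bin_weight m \<nu> p)"
      using assms by (intro summable_com_neg_bin_weight)
    fix i
    have "Gamma x \<noteq> 0" if "x > 0" for x :: real
      using Gamma_real_pos[OF that] by simp
    hence "Gamma (m + real i) \<noteq> 0" "Gamma m \<noteq> 0"
      using assms by (simp_all add: add_pos_nonneg)
    thus "com_neg_bin_weight m \<nu> p i > 0"
      using assms unfolding com_neg_bin_weight_def
      by (intro mult_pos_pos powr_gt_zero[THEN iffD2] zero_less_power) auto
  qed
  with lim lim_sum have "((\<lambda>x. w k x / (\<Sum>i. w i x)) \<longlongrightarrow>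
      com_neg_bin_weight m \<nu> p k / com_neg_bin_normalizer m \<nu> p) F"
    by (intro tendsto_divide) auto
  \<comment> \<open>The scale and the weight at 0 cancel, so the quotient is exactly the probability
    once \<open>n \<ge> 1\<close>.\<close>
  moreover have "eventually (\<lambda>x. w k x / (\<Sum>i. w i x) =
      (case x of (z, n) \<Rightarrow> pmf (com_neg_hyp_pmf z \<nu> m n) k)) F"
    using adm
  proof eventually_elim
    case (elim x)
    obtain z n where x: "x = (z, n)" by (cases x)
    show ?case
      using elim assms c com_neg_hyp_mass_eq[of m n c z \<nu> k] pmf_com_neg_hyp[of m n z \<nu> k]
      by (simp add: x w_def)
  qed
  ultimately have "((\<lambda>(z, n). pmf (com_neg_hyp_pmf z \<nu> m n) k) \<longlongrightarrow>
      com_neg_bin_weight m \<nu> p k / com_neg_bin_normalizer m \<nu> p) F"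
    by (rule Lim_transform_eventually)
  thus ?thesis
    by (simp add: F_def com_neg_bin_weight_def)
qed

end
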